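(* Let $\mathbb{F}$ be a field and let $W(t)=\sum_{n=0}^{\infty}\frac{t^n}{w_n}\in\mathbb{F}[[t]]$ with $w_0=1$ and $w_n\neq0$ for all $n$. The group of $W$-Appell sequences (viewed as a subset of $L$) is the stabilizer of $M_W$ in $L$, with respect to the right action in which $A\in L$ takes a strictly lower triangular matrix $M$ to $A^{-1}MA$. The group $R_W$ of $W$-Riordan arrays (equivalently, of $W$-Sheffer sequences) is the normalizer in $L$ of the group of $W$-Appell sequences.
   Context: $\mathbb{N}=\{0,1,2,\dots\}$. $L$ is the group, under matrix multiplication, of infinite lower triangular matrices $(a_{n,k})_{n,k\in\mathbb{N}}$ over $\mathbb{F}$ with non-zero diagonal entries. A graded sequence of polynomials $\{p_n\}_{n\in\mathbb{N}}$ in $\mathbb{F}[x]$ (meaning $\deg p_n=n$) is identified with the matrix $A\in L$ with $p_n(x)=\sum_{k=0}^na_{n,k}x^k$. Strictly lower triangular matrices are the infinite lower triangular matrices with zero diagonal. $M_W$ is the strictly lower triangular matrix whose $(n,k)$-entry is $\frac{w_n}{w_{n-1}}$ if $k=n-1$ and $0$ otherwise. $D_W$ is the linear operator on $\mathbb{F}[x]$ taking $\frac{x^n}{w_n}$ to $\frac{x^{n-1}}{w_{n-1}}$ for $n\geq1$ and $1$ to $0$. For a graded sequence with matrix $A$, $Q_{A,W}$ is the linear operator sending $\frac{p_n}{w_n}$ to $\frac{p_{n-1}}{w_{n-1}}$ for $n\ge1$ and $p_0$ to $0$. The graded sequence is $W$-Appell if $Q_{A,W}=D_W$. For $h\in\mathbb{F}$,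 $T_{h,W}$ is the linear operator on $\mathbb{F}[x]$ taking $\frac{x^n}{w_n}$ to $\sum_{k=0}^n\frac{h^{n-k}}{w_{n-k}}\cdot\frac{x^k}{w_k}$; the graded sequence is $W$-Sheffer if $Q_{A,W}$ commutes with $T_{h,W}$ for all $h\in\mathbb{F}$. $R_W$ is the set of $W$-Riordan arrays: those $A\in L$ such that, with $C_k(y)=\sum_{n=0}^\infty a_{n,k}\frac{y^n}{w_n}\in\mathbb{F}[[y]]$, the quotient $\frac{w_{k+1}C_{k+1}}{w_kC_k}$ is independent of $k$. It is a subgroup of $L$ and consists exactly of the matrices of $W$-Sheffer sequences. *)

theory Defs
  imports
    "HOL-Computational_Algebra.Polynomial"
    "HOL-Computational_Algebra.Formal_Power_Series"
    "HOL-Algebra.Group_Action"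
begin

text \<open>
  Throughout, the series $W(t) = \sum_n t^n / w_n$ is given by its sequence of weights \<open>w\<close>; the
  standing assumptions \<open>w 0 = 1\<close> and \<open>w n \<noteq> 0\<close> are hypotheses of the theorem.
  An infinite matrix is a function \<open>nat \<Rightarrow> nat \<Rightarrow> 'a\<close> (row index first).
\<close>

section \<open>Lower triangular matrices\<close>

definition lower_tri :: "(nat \<Rightarrow> nat \<Rightarrow> 'a::zero) set" where
  "lower_tri = {A. \<forall>n k. n < k \<longrightarrow> A n k = 0}"

definition strictly_lower_tri :: "(nat \<Rightarrow> nat \<Rightarrow> 'a::zero) set" where
  "strictly_lower_tri = {A \<in> lower_tri. \<forall>n. A n n = 0}"

text \<open>The product of infinite matrices whose left factor is lower triangular, so that only the
  terms with \<open>j \<le> n\<close> contribute.\<close>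

definition mat_mult :: "(nat \<Rightarrow> nat \<Rightarrow> 'a::semiring_0) \<Rightarrow> (nat \<Rightarrow> nat \<Rightarrow> 'a) \<Rightarrow> nat \<Rightarrow> nat \<Rightarrow> 'a"
    (infixl \<open>\<star>\<close> 70) where
  "A \<star> B = (\<lambda>n k. \<Sum>j\<le>n. A n j * B j k)"

definition L_group :: "(nat \<Rightarrow> nat \<Rightarrow> 'a::field) monoid" where
  "L_group = \<lparr>carrier = {A \<in> lower_tri. \<forall>n. A n n \<noteq> 0},
              monoid.mult = (\<star>),
              one = (\<lambda>n k. if n = k then 1 else 0)\<rparr>"

definition conj_action ::
    "(nat \<Rightarrow> nat \<Rightarrow> 'a::field) \<Rightarrow> (nat \<Rightarrow> nat \<Rightarrow> 'a) \<Rightarrow> nat \<Rightarrow> nat \<Rightarrow> 'a" where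
  "conj_action A = (\<lambda>M \<in> strictly_lower_tri. (inv\<^bsub>L_group\<^esub> A) \<star> M \<star> A)"

definition M_mat :: "(nat \<Rightarrow> 'a::field) \<Rightarrow> nat \<Rightarrow> nat \<Rightarrow> 'a" where
  "M_mat w = (\<lambda>n k. if n = Suc k then w n / w k else 0)"

section \<open>Graded sequences and operators on polynomials\<close>

text \<open>The zero polynomial has \<open>degree\<close> 0 in the library, hence the explicit condition
  \<open>p n \<noteq> 0\<close> (relevant for \<open>n = 0\<close> only).\<close>

definition graded_seq :: "(nat \<Rightarrow> 'a::field poly) \<Rightarrow> bool" where
  "graded_seq p \<longleftrightarrow> (\<forall>n. p n \<noteq> 0 \<and> degree (p n) = n)"

definition seq_matrix :: "(nat \<Rightarrow> 'a::field poly) \<Rightarrow> nat \<Rightarrow> nat \<Rightarrow> 'a" where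
  "seq_matrix p = (\<lambda>n k. coeff (p n) k)"

text \<open>\<open>lin_op b q\<close> is the linear operator taking \<open>b n\<close> to \<open>q n\<close> for all \<open>n\<close>. It is only used for
  graded sequences \<open>b\<close>, for which it is well-defined, see \<open>lin_op_ex1\<close> below.\<close>

definition lin_op :: "(nat \<Rightarrow> 'a::field poly) \<Rightarrow> (nat \<Rightarrow> 'a poly) \<Rightarrow> 'a poly \<Rightarrow> 'a poly" where
  "lin_op b q = (THE T. Vector_Spaces.linear smult smult T \<and> (\<forall>n. T (b n) = q n))"

text \<open>In the next two definitions the case \<open>n = 0\<close> prescribes the image of \<open>p 0 / w 0\<close> (of
  \<open>1 / w 0\<close>, respectively), which is the same as prescribing that of \<open>p 0\<close> (of \<open>1\<close>) because
  \<open>w 0 = 1\<close>.\<close>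

definition Q_op :: "(nat \<Rightarrow> 'a::field) \<Rightarrow> (nat \<Rightarrow> 'a poly) \<Rightarrow> 'a poly \<Rightarrow> 'a poly" where
  "Q_op w p = lin_op (\<lambda>n. smult (1 / w n) (p n))
                     (\<lambda>n. if n = 0 then 0 else smult (1 / w (n - 1)) (p (n - 1)))"

definition D_op :: "(nat \<Rightarrow> 'a::field) \<Rightarrow> 'a poly \<Rightarrow> 'a poly" where
  "D_op w = lin_op (\<lambda>n. monom (1 / w n) n)
                   (\<lambda>n. if n = 0 then 0 else monom (1 / w (n - 1)) (n - 1))"

definition T_op :: "(nat \<Rightarrow> 'a::field) \<Rightarrow> 'a \<Rightarrow> 'a poly \<Rightarrow> 'a poly" where
  "T_op w h = lin_op (\<lambda>n. monom (1 / w n) n)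
                     (\<lambda>n. \<Sum>k\<le>n. smult (h ^ (n - k) / w (n - k)) (monom (1 / w k) k))"

section \<open>Appell sequences, Sheffer sequences, Riordan arrays\<close>

definition W_Appell :: "(nat \<Rightarrow> 'a::field) \<Rightarrow> (nat \<Rightarrow> 'a poly) \<Rightarrow> bool" where
  "W_Appell w p \<longleftrightarrow> graded_seq p \<and> Q_op w p = D_op w"

definition W_Sheffer :: "(nat \<Rightarrow> 'a::field) \<Rightarrow> (nat \<Rightarrow> 'a poly) \<Rightarrow> bool" where
  "W_Sheffer w p \<longleftrightarrow> graded_seq p \<and> (\<forall>h. Q_op w p \<circ> T_op w h = T_op w h \<circ> Q_op w p)"

definition Appell_matrices :: "(nat \<Rightarrow> 'a::field) \<Rightarrow> (nat \<Rightarrow> nat \<Rightarrow> 'a) set" where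
  "Appell_matrices w = {seq_matrix p | p. W_Appell w p}"

definition Sheffer_matrices :: "(nat \<Rightarrow> 'a::field) \<Rightarrow> (nat \<Rightarrow> nat \<Rightarrow> 'a) set" where
  "Sheffer_matrices w = {seq_matrix p | p. W_Sheffer w p}"

definition col_fps :: "(nat \<Rightarrow> 'a::field) \<Rightarrow> (nat \<Rightarrow> nat \<Rightarrow> 'a) \<Rightarrow> nat \<Rightarrow> 'a fps" where
  "col_fps w A k = Abs_fps (\<lambda>n. A n k / w n)"

text \<open>For \<open>A\<close> in \<open>L_group\<close>, the \<open>k\<close>-th column series has order exactly \<open>k\<close>, so the division of
  power series below is exact.\<close>

definition Riordan :: "(nat \<Rightarrow> 'a::field) \<Rightarrow> (nat \<Rightarrow> nat \<Rightarrow> 'a) set" where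
  "Riordan w = {A \<in> carrier L_group. \<exists>r. \<forall>k.
     (fps_const (w (Suc k)) * col_fps w A (Suc k)) / (fps_const (w k) * col_fps w A k) = r}"

section \<open>Well-definedness\<close>

lemma smult_vector_space: "vector_space (smult :: 'a::field \<Rightarrow> 'a poly \<Rightarrow> 'a poly)"
  by unfold_locales (simp_all add: smult_add_right smult_add_left)

lemma linear_smult_iff:
  "Vector_Spaces.linear smult smult (T :: 'a::field poly \<Rightarrow> 'a poly) \<longleftrightarrow>
     (\<forall>f g. T (f + g) = T f + T g) \<and> (\<forall>c f. T (smult c f) = smult c (T f))"
  unfolding Vector_Spaces.linear_iff using smult_vector_space by blast

primrec lin_op_aux ::
    "(nat \<Rightarrow> 'a::field poly) \<Rightarrow> (nat \<Rightarrow> 'a poly) \<Rightarrow> nat \<Rightarrow> 'a poly \<Rightarrow> 'a poly" where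
  "lin_op_aux b q 0 f = 0"
| "lin_op_aux b q (Suc N) f =
     (let c = coeff f N / coeff (b N) N in smult c (q N) + lin_op_aux b q N (f - smult c (b N)))"

lemma lin_op_aux_add: "lin_op_aux b q N (f + g) = lin_op_aux b q N f + lin_op_aux b q N g"
proof (induction N arbitrary: f g)
  case (Suc N)
  let ?c = "\<lambda>f. coeff f N / coeff (b N) N"
  have "f + g - smult (?c (f + g)) (b N) = (f - smult (?c f) (b N)) + (g - smult (?c g) (b N))"
    by (simp add: add_divide_distrib smult_add_left)
  then show ?case
    by (simp only: lin_op_aux.simps Let_def Suc.IH) (simp add: add_divide_distrib smult_add_left)
qed simp

lemma lin_op_aux_smult: "lin_op_aux b q N (smult a f) = smult a (lin_op_aux b q N f)"
proof (induction N arbitrary: f)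
  case (Suc N)
  let ?c = "\<lambda>f. coeff f N / coeff (b N) N"
  have "smult a f - smult (?c (smult a f)) (b N) = smult a (f - smult (?c f) (b N))"
    by (simp add: smult_diff_right)
  then show ?case
    by (simp only: lin_op_aux.simps Let_def Suc.IH) (simp add: smult_add_right)
qed simp

lemma lin_op_aux_mono:
  assumes "\<forall>i\<ge>N. coeff f i = 0" "N \<le> M"
  shows "lin_op_aux b q M f = lin_op_aux b q N f"
  using assms(2,1) by (induction M rule: dec_induct) simp_all

lemma lin_op_ex1:
  assumes b: "graded_seq b"
  shows "\<exists>!T. Vector_Spaces.linear smult smult T \<and> (\<forall>n. T (b n) = q n)"
proof (rule ex_ex1I)
  define T where "T f = lin_op_aux b q (Suc (degree f)) f" for f
  have T: "T f = lin_op_aux b q N f" if "degree f < N" for f N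
    unfolding T_def by (rule lin_op_aux_mono[symmetric]) (use that in \<open>auto intro: coeff_eq_0\<close>)
  have "T (f + g) = T f + T g" for f g
  proof -
    define N where "N = Suc (max (degree f) (degree g))"
    have "degree (f + g) < N" "degree f < N" "degree g < N"
      using degree_add_le_max[of f g] by (auto simp: N_def)
    then show ?thesis by (simp add: T lin_op_aux_add)
  qed
  moreover have "T (smult c f) = smult c (T f)" for c f
    using T[of "smult c f" "Suc (degree f)"] T[of f "Suc (degree f)"] degree_smult_le[of c f]
    by (simp add: lin_op_aux_smult del: lin_op_aux.simps)
  moreover have "T (b n) = q n" for n
  proof -
    have "coeff (b n) n \<noteq> 0"
      using b by (metis graded_seq_def leading_coeff_0_iff)
    moreover have "lin_op_aux b q n 0 = 0"
      using lin_op_aux_smult[of b q n 0 0] by simp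
    ultimately show ?thesis
      using b T[of "b n" "Suc n"] by (simp add: graded_seq_def)
  qed
  ultimately show "\<exists>T. Vector_Spaces.linear smult smult T \<and> (\<forall>n. T (b n) = q n)"
    by (auto simp: linear_smult_iff)
next
  fix S T :: "'a poly \<Rightarrow> 'a poly"
  assume S: "Vector_Spaces.linear smult smult S \<and> (\<forall>n. S (b n) = q n)"
    and T: "Vector_Spaces.linear smult smult T \<and> (\<forall>n. T (b n) = q n)"
  have "S f = T f" if "\<forall>i\<ge>N. coeff f i = 0" for f N
    using that
  proof (induction N arbitrary: f)
    case 0
    then have "f = smult 0 f" by (simp add: poly_eq_iff)
    then show ?case using S T by (metis linear_smult_iff smult_0_left)
  next
    case (Suc N)
    define c where "c = coeff f N / coeff (b N) N"
    have "coeff (b N) N \<noteq> 0"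
      using b by (metis graded_seq_def leading_coeff_0_iff)
    then have "coeff (f - smult c (b N)) N = 0"
      by (simp add: c_def)
    moreover have "coeff (f - smult c (b N)) i = 0" if "i > N" for i
      using Suc.prems that b by (simp add: graded_seq_def coeff_eq_0)
    ultimately have "S (f - smult c (b N)) = T (f - smult c (b N))"
      by (intro Suc.IH) (metis le_neq_implies_less)
    moreover have "f = (f - smult c (b N)) + smult c (b N)" by simp
    ultimately show ?case using S T by (metis linear_smult_iff)
  qed
  then show "S = T"
    by (meson coeff_eq_0 ext less_le_trans lessI)
qed

lemma mat_mult_assoc: "B \<in> lower_tri \<Longrightarrow> A \<star> B \<star> C = A \<star> (B \<star> C)"
proof (intro ext)
  fix n k assume B: "B \<in> lower_tri"
  have "(A \<star> B \<star> C) n k = (\<Sum>i\<le>n. A n i * (\<Sum>j\<le>n. B i j * C j k))"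
    unfolding mat_mult_def sum_distrib_right sum_distrib_left mult.assoc by (rule sum.swap)
  also have "\<dots> = (\<Sum>i\<le>n. A n i * (\<Sum>j\<le>i. B i j * C j k))"
    using B by (intro sum.cong arg_cong2[where f = times] refl sum.mono_neutral_right)
      (auto simp: lower_tri_def)
  finally show "(A \<star> B \<star> C) n k = (A \<star> (B \<star> C)) n k"
    by (simp add: mat_mult_def)
qed

lemma mat_mult_lower: "A \<in> lower_tri \<Longrightarrow> B \<in> lower_tri \<Longrightarrow> A \<star> B \<in> lower_tri"
  by (auto simp: lower_tri_def mat_mult_def intro!: sum.neutral)

lemma mat_mult_diag:
  assumes "B \<in> lower_tri"
  shows "(A \<star> B) n n = A n n * B n n"
proof -
  have "(A \<star> B) n n = (\<Sum>j\<in>{n}. A n j * B j n)"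
    unfolding mat_mult_def
    using assms by (intro sum.mono_neutral_right) (auto simp: lower_tri_def)
  then show ?thesis by simp
qed

fun right_inv_entry :: "(nat \<Rightarrow> nat \<Rightarrow> 'a::field) \<Rightarrow> nat \<Rightarrow> nat \<Rightarrow> 'a" where
  "right_inv_entry A k n =
     ((if n = k then 1 else 0) - (\<Sum>j<n. A n j * right_inv_entry A k j)) / A n n"

declare right_inv_entry.simps [simp del]

lemma group_L: "group (L_group :: (nat \<Rightarrow> nat \<Rightarrow> 'a::field) monoid)"
proof -
  let ?L = "L_group :: (nat \<Rightarrow> nat \<Rightarrow> 'a) monoid"
  have mon: "monoid ?L"
  proof (rule monoidI)
    show "x \<otimes>\<^bsub>?L\<^esub> y \<in> carrier ?L" if "x \<in> carrier ?L" "y \<in> carrier ?L" for x y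
      using that by (auto simp: L_group_def mat_mult_lower mat_mult_diag)
    show "\<one>\<^bsub>?L\<^esub> \<in> carrier ?L"
      by (auto simp: L_group_def lower_tri_def)
    show "x \<otimes>\<^bsub>?L\<^esub> y \<otimes>\<^bsub>?L\<^esub> z = x \<otimes>\<^bsub>?L\<^esub> (y \<otimes>\<^bsub>?L\<^esub> z)" if "y \<in> carrier ?L" for x y z
      using that by (auto simp: L_group_def mat_mult_assoc)
    show "\<one>\<^bsub>?L\<^esub> \<otimes>\<^bsub>?L\<^esub> x = x" for x
      by (simp add: L_group_def mat_mult_def if_distrib[where f = "\<lambda>c. c * _"] cong: if_cong)
    show "x \<otimes>\<^bsub>?L\<^esub> \<one>\<^bsub>?L\<^esub> = x" if "x \<in> carrier ?L" for x
      using that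
      by (auto simp: L_group_def mat_mult_def lower_tri_def fun_eq_iff
          if_distrib[where f = "\<lambda>c. _ * c"] cong: if_cong)
  qed
  have rinv: "\<exists>y \<in> carrier ?L. x \<otimes>\<^bsub>?L\<^esub> y = \<one>\<^bsub>?L\<^esub>" if x: "x \<in> carrier ?L" for x
  proof
    let ?y = "\<lambda>n k. right_inv_entry x k n"
    have d: "x n n \<noteq> 0" for n using x by (simp add: L_group_def)
    have low: "?y n k = 0" if "n < k" for n k
      using that
      by (induction n rule: less_induct) (subst right_inv_entry.simps, auto intro!: sum.neutral)
    then have "?y n n = 1 / x n n" for n
      by (subst right_inv_entry.simps) (auto intro!: sum.neutral)
    with low d show "?y \<in> carrier ?L"
      by (auto simp: L_group_def lower_tri_def)
    have "x n n * ?y n k = (if n = k then 1 else 0) - (\<Sum>j<n. x n j * ?y j k)" for n k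
      by (subst right_inv_entry.simps) (simp add: d)
    then show "x \<otimes>\<^bsub>?L\<^esub> ?y = \<one>\<^bsub>?L\<^esub>"
      by (simp add: L_group_def mat_mult_def flip: lessThan_Suc_atMost)
  qed
  have "x \<in> Units ?L" if x: "x \<in> carrier ?L" for x
  proof -
    obtain y z where y: "y \<in> carrier ?L" "x \<otimes>\<^bsub>?L\<^esub> y = \<one>\<^bsub>?L\<^esub>"
      and z: "z \<in> carrier ?L" "y \<otimes>\<^bsub>?L\<^esub> z = \<one>\<^bsub>?L\<^esub>"
      using rinv x by metis
    have "x = z"
      using x y z
      by (metis mon monoid.l_one monoid.m_assoc monoid.r_one)
    with x y z show ?thesis by (auto simp: Units_def)
  qed
  then show ?thesis
    using mon by (intro group.intro) (auto simp: group_axioms_def)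
qed

lemma M_mat_strictly_lower: "M_mat w \<in> strictly_lower_tri"
  by (auto simp: M_mat_def strictly_lower_tri_def lower_tri_def)

lemma conj_action_closed:
  assumes "A \<in> carrier L_group" "M \<in> strictly_lower_tri"
  shows "conj_action A M \<in> strictly_lower_tri"
proof -
  have "inv\<^bsub>L_group\<^esub> A \<in> carrier L_group"
    using group.inv_closed[OF group_L] assms by blast
  then show ?thesis
    using assms
    by (auto simp: conj_action_def strictly_lower_tri_def L_group_def mat_mult_lower mat_mult_diag)
qed

lemma conj_action_mult:
  assumes A: "A \<in> carrier L_group" and B: "B \<in> carrier L_group" and M: "M \<in> strictly_lower_tri"
  shows "conj_action (A \<otimes>\<^bsub>L_group\<^esub> B) M = conj_action B (conj_action A M)"
proof -
  let ?i = "\<lambda>X. inv\<^bsub>L_group\<^esub> X"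
  have iA: "?i A \<in> carrier L_group" and iB: "?i B \<in> carrier L_group"
    using group.inv_closed[OF group_L] A B by blast+
  have "?i (A \<otimes>\<^bsub>L_group\<^esub> B) = ?i B \<star> ?i A"
    using group.inv_mult_group[OF group_L A B] by (simp add: L_group_def)
  moreover have "A \<otimes>\<^bsub>L_group\<^esub> B = A \<star> B" by (simp add: L_group_def)
  moreover have "A \<in> lower_tri" "M \<in> lower_tri" "?i A \<in> lower_tri" "?i B \<in> lower_tri"
    using A M iA iB by (auto simp: L_group_def strictly_lower_tri_def)
  ultimately show ?thesis
    using conj_action_closed[OF A M] M
    by (simp add: conj_action_def mat_mult_assoc mat_mult_lower)
qed

lemma conj_action_one:
  assumes "M \<in> strictly_lower_tri"
  shows "conj_action \<one>\<^bsub>L_group\<^esub> M = M"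
proof -
  interpret group L_group by (rule group_L)
  show ?thesis
    using assms unfolding conj_action_def inv_one
    by (auto simp: L_group_def mat_mult_def strictly_lower_tri_def lower_tri_def fun_eq_iff
        if_distrib[where f = "\<lambda>c. _ * c"] if_distrib[where f = "\<lambda>c. c * _"] cong: if_cong)
qed

end

theory Submission
  imports Defs
begin

text \<open>
  Write $M$ for \<open>M_mat w\<close>. Every class of matrices in the theorem is described by how its
  members intertwine power series in $M$, and the theorem becomes a statement about the
  centralizer of one element of a group.

  \<^item> Passing from an operator $T$ on polynomials to the matrix whose $n$-th row is
  $T(x^n)$ reverses composition, and turns $D_W$ into $M$, $T_{h,W}$ into $W(hM)$, and $Q_{A,W}$ into
  $A^{-1}MA$. Hence $A$ is Appell iff it commutes with $M$, and $A$ is Sheffer iff $A^{-1}MA$ commutes with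
  all $W(hM)$.
  \<^item> Multiplying $A$ by $f(M)$ on the left multiplies every column series of $A$ by $f$, while
  multiplying by $M$ on the right shifts the columns (with weights). So $A$ is Riordan with
  quotient $r$ iff $AM = r(M)A$ (\<open>Riordan_iff\<close>).
  \<^item> A lower triangular matrix commuting with $f(M)$, where $f$ has a non-zero linear
  coefficient, is itself a power series in $M$ (\<open>commute_M_series_iff\<close>). With $f = t$ this describes
  the centralizer of $M$, which is therefore commutative. With $f = W$ it shows that commuting
  with $T_{1,W}$ alone forces $A^{-1}MA = q(M)$ for some $q$, over every field, even a finite one.

  The matrix $M$ is not invertible, but $E = 1 + M$ lies in $L$ and intertwining relations for $M$ and
  for $E$ are the same. Let $C$ be the centralizer of $E$ in $L$: it is the set of Appell matrices, which is
  also the stabilizer of $M$. Then $A$ is Riordan iff $AEA^{-1} \<in> C$ and Sheffer iff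
  $A^{-1}EA \<in> C$. These conditions agree, because the first says that $AEA^{-1}$ commutes with $E$,
  and conjugating this by $A^{-1}$ gives that $E$ commutes with $A^{-1}EA$. That they describe the
  normalizer of $C$ holds in any group for an element $E$ with abelian centralizer
  (\<open>normalizer_abelian_centralizer\<close>).
\<close>

section \<open>Abelian centralizers and their normalizers\<close>

context group
begin

lemma conj_mult_conj:
  assumes "a \<in> carrier G" "x \<in> carrier G" "y \<in> carrier G"
  shows "(a \<otimes> x \<otimes> inv a) \<otimes> (a \<otimes> y \<otimes> inv a) = a \<otimes> (x \<otimes> y) \<otimes> inv a"
proof -
  have "inv a \<otimes> (a \<otimes> (y \<otimes> inv a)) = y \<otimes> inv a"
    using assms by (simp flip: m_assoc)
  then show ?thesis using assms by (simp add: m_assoc)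
qed

text \<open>
  Conjugation by \<open>a\<close> is an automorphism, and it takes \<open>inv a \<otimes> y \<otimes> a\<close> to \<open>y\<close>.
\<close>

lemma conj_commute_iff:
  assumes "a \<in> carrier G" "x \<in> carrier G" "y \<in> carrier G"
  shows "(a \<otimes> x \<otimes> inv a) \<otimes> y = y \<otimes> (a \<otimes> x \<otimes> inv a) \<longleftrightarrow>
         x \<otimes> (inv a \<otimes> y \<otimes> a) = (inv a \<otimes> y \<otimes> a) \<otimes> x"
proof -
  define z where "z = inv a \<otimes> y \<otimes> a"
  have z: "z \<in> carrier G" using assms by (simp add: z_def)
  have "y = a \<otimes> z \<otimes> inv a"
    using assms by (simp add: z_def m_assoc) (simp flip: m_assoc)
  then have "(a \<otimes> x \<otimes> inv a) \<otimes> y = y \<otimes> (a \<otimes> x \<otimes> inv a) \<longleftrightarrow>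
      a \<otimes> (x \<otimes> z) \<otimes> inv a = a \<otimes> (z \<otimes> x) \<otimes> inv a"
    using assms z by (simp add: conj_mult_conj)
  also have "\<dots> \<longleftrightarrow> x \<otimes> z = z \<otimes> x"
    using assms z by simp
  finally show ?thesis by (simp add: z_def)
qed

text \<open>
  The normalizer asks for equality of \<open>H\<close> with its conjugate. The inclusion of \<open>H\<close> in its
  conjugate by \<open>a\<close> is the same as stability of \<open>H\<close> under conjugation by \<open>inv a\<close>.
\<close>

lemma normalizer_iff:
  assumes H: "H \<subseteq> carrier G" and a: "a \<in> carrier G"
  shows "a \<in> normalizer G H \<longleftrightarrow>
         (\<forall>h\<in>H. a \<otimes> h \<otimes> inv a \<in> H) \<and> (\<forall>h\<in>H. inv a \<otimes> h \<otimes> a \<in> H)"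
proof -
  have cancel: "a \<otimes> (inv a \<otimes> h \<otimes> a) \<otimes> inv a = h" "inv a \<otimes> (a \<otimes> h \<otimes> inv a) \<otimes> a = h"
    if "h \<in> H" for h
  proof -
    have h: "h \<in> carrier G" using that H by blast
    show "a \<otimes> (inv a \<otimes> h \<otimes> a) \<otimes> inv a = h"
      using a h by (simp add: m_assoc) (simp flip: m_assoc)
    show "inv a \<otimes> (a \<otimes> h \<otimes> inv a) \<otimes> a = h"
      using a h by (simp add: m_assoc) (simp flip: m_assoc)
  qed
  have "a \<in> normalizer G H \<longleftrightarrow> (\<lambda>h. a \<otimes> h \<otimes> inv a) ` H = H"
  proof -
    have "a <# H #> inv a = (\<lambda>h. a \<otimes> h \<otimes> inv a) ` H"
      by (auto simp: r_coset_def l_coset_def)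
    then show ?thesis using H a by (simp add: normalizer_def stabilizer_def)
  qed
  also have "\<dots> \<longleftrightarrow> (\<forall>h\<in>H. a \<otimes> h \<otimes> inv a \<in> H) \<and> (\<forall>h\<in>H. inv a \<otimes> h \<otimes> a \<in> H)"
  proof
    assume eq: "(\<lambda>h. a \<otimes> h \<otimes> inv a) ` H = H"
    have "inv a \<otimes> h \<otimes> a \<in> H" if "h \<in> H" for h
    proof -
      from that have "h \<in> (\<lambda>h. a \<otimes> h \<otimes> inv a) ` H" by (simp only: eq)
      then obtain g where g: "g \<in> H" "h = a \<otimes> g \<otimes> inv a" by (rule imageE)
      then show ?thesis using cancel(2)[OF g(1)] by simp
    qed
    moreover have "a \<otimes> h \<otimes> inv a \<in> H" if "h \<in> H" for h
      using imageI[OF that, of "\<lambda>h. a \<otimes> h \<otimes> inv a"] eq by simp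
    ultimately show "(\<forall>h\<in>H. a \<otimes> h \<otimes> inv a \<in> H) \<and> (\<forall>h\<in>H. inv a \<otimes> h \<otimes> a \<in> H)"
      by simp
  next
    assume stable: "(\<forall>h\<in>H. a \<otimes> h \<otimes> inv a \<in> H) \<and> (\<forall>h\<in>H. inv a \<otimes> h \<otimes> a \<in> H)"
    show "(\<lambda>h. a \<otimes> h \<otimes> inv a) ` H = H"
    proof (intro equalityI subsetI)
      fix h assume h: "h \<in> H"
      then have "inv a \<otimes> h \<otimes> a \<in> H" by (rule bspec[OF conjunct2[OF stable]])
      from imageI[OF this, of "\<lambda>h. a \<otimes> h \<otimes> inv a"]
      show "h \<in> (\<lambda>h. a \<otimes> h \<otimes> inv a) ` H"
        unfolding cancel(1)[OF h] .
    qed (use conjunct1[OF stable] in auto)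
  qed
  finally show ?thesis .
qed

lemma centralizer_subgroup:
  assumes e: "e \<in> carrier G"
  shows "subgroup {g \<in> carrier G. g \<otimes> e = e \<otimes> g} G"
proof (rule subgroupI)
  show "{g \<in> carrier G. g \<otimes> e = e \<otimes> g} \<noteq> {}" using e by blast
next
  fix g assume "g \<in> {g \<in> carrier G. g \<otimes> e = e \<otimes> g}"
  then have g: "g \<in> carrier G" "g \<otimes> e = e \<otimes> g" by auto
  have "inv g \<otimes> e = inv g \<otimes> (e \<otimes> g) \<otimes> inv g"
    using e g(1) by (simp add: m_assoc)
  also have "\<dots> = inv g \<otimes> (g \<otimes> e) \<otimes> inv g"
    by (simp only: g(2))
  also have "\<dots> = e \<otimes> inv g"
    using e g(1) by (simp flip: m_assoc)
  finally show "inv g \<in> {g \<in> carrier G. g \<otimes> e = e \<otimes> g}"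
    using g(1) by simp
next
  fix g h
  assume "g \<in> {g \<in> carrier G. g \<otimes> e = e \<otimes> g}" "h \<in> {g \<in> carrier G. g \<otimes> e = e \<otimes> g}"
  then have gh: "g \<in> carrier G" "h \<in> carrier G"
    and comm: "g \<otimes> e = e \<otimes> g" "h \<otimes> e = e \<otimes> h" by auto
  have "g \<otimes> h \<otimes> e = g \<otimes> (e \<otimes> h)"
    using gh e by (simp add: m_assoc comm(2))
  also have "\<dots> = e \<otimes> g \<otimes> h"
    using gh e by (simp add: comm(1) flip: m_assoc)
  also have "\<dots> = e \<otimes> (g \<otimes> h)"
    using gh e by (simp add: m_assoc)
  finally show "g \<otimes> h \<in> {g \<in> carrier G. g \<otimes> e = e \<otimes> g}"
    using gh by simp
qed auto

text \<open>
  This symmetry is what identifies Riordan arrays, which concern conjugation by \<open>a\<close>, with Sheffer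
  matrices, which concern conjugation by \<open>inv a\<close>.
\<close>

lemma conj_commute_flip:
  assumes "a \<in> carrier G" "e \<in> carrier G"
  shows "(a \<otimes> e \<otimes> inv a) \<otimes> e = e \<otimes> (a \<otimes> e \<otimes> inv a) \<longleftrightarrow>
         (inv a \<otimes> e \<otimes> a) \<otimes> e = e \<otimes> (inv a \<otimes> e \<otimes> a)"
  using conj_commute_iff[of a e e] assms by auto

text \<open>
  A normalizing \<open>a\<close> takes \<open>e\<close>, a member of \<open>C\<close>, into \<open>C\<close>. Conversely, if the conjugate \<open>k\<close>
  of \<open>e\<close> by \<open>inv a\<close> lies in the abelian group \<open>C\<close>, then every \<open>g\<close> in \<open>C\<close> commutes with \<open>k\<close>,
  and conjugating by \<open>a\<close> shows that the conjugate of \<open>g\<close> by \<open>a\<close> commutes with \<open>e\<close>. By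
  \<open>conj_commute_flip\<close>, the hypothesis for \<open>a\<close> and the one for \<open>inv a\<close> are equivalent, which gives both
  inclusions.
\<close>

lemma normalizer_abelian_centralizer:
  assumes e: "e \<in> carrier G"
    and C: "C = {g \<in> carrier G. g \<otimes> e = e \<otimes> g}"
    and abelian: "\<And>g h. g \<in> C \<Longrightarrow> h \<in> C \<Longrightarrow> g \<otimes> h = h \<otimes> g"
  shows "normalizer G C = {a \<in> carrier G. a \<otimes> e \<otimes> inv a \<in> C}"
proof -
  have CG: "C \<subseteq> carrier G" by (auto simp: C)
  have "e \<in> C" using e by (simp add: C)
  have stable: "a \<otimes> g \<otimes> inv a \<in> C"
    if a: "a \<in> carrier G" and K: "inv a \<otimes> e \<otimes> a \<in> C" and g: "g \<in> C" for a g
  proof -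
    have g': "g \<in> carrier G" using g by (simp add: C)
    have "(a \<otimes> g \<otimes> inv a) \<otimes> e = e \<otimes> (a \<otimes> g \<otimes> inv a)"
      using abelian[OF g K] by (subst conj_commute_iff[OF a g' e])
    then show ?thesis using a g' by (simp add: C)
  qed
  have "a \<in> normalizer G C \<longleftrightarrow> a \<otimes> e \<otimes> inv a \<in> C" if a: "a \<in> carrier G" for a
  proof
    assume "a \<in> normalizer G C"
    with \<open>e \<in> C\<close> show "a \<otimes> e \<otimes> inv a \<in> C" by (simp add: normalizer_iff[OF CG a])
  next
    assume N: "a \<otimes> e \<otimes> inv a \<in> C"
    then have "inv a \<otimes> e \<otimes> a \<in> C"
      unfolding C mem_Collect_eq conj_commute_flip[OF a e] using a e by simp
    then show "a \<in> normalizer G C"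
      using stable[OF a] stable[of "inv a"] N a by (simp add: normalizer_iff[OF CG a])
  qed
  moreover have "normalizer G C \<subseteq> carrier G"
    by (auto simp: normalizer_def stabilizer_def)
  ultimately show ?thesis by blast
qed

end

section \<open>Power series in the matrix of the generalized derivative\<close>

text \<open>
  The matrix $f(M)$ for $M$ = \<open>M_mat w\<close>: the $j$-th power of $M$ has entries $w_n / w_k$ at $n = k + j$ and
  zeros elsewhere.
\<close>

definition M_series :: "(nat \<Rightarrow> 'a::field) \<Rightarrow> 'a fps \<Rightarrow> nat \<Rightarrow> nat \<Rightarrow> 'a" where
  "M_series w f = (\<lambda>n k. if k \<le> n then w n / w k * fps_nth f (n - k) else 0)"

lemma M_series_lower: "M_series w f \<in> lower_tri"
  by (simp add: M_series_def lower_tri_def)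

lemma M_mat_lower: "M_mat w \<in> lower_tri"
  using M_mat_strictly_lower by (auto simp: strictly_lower_tri_def)

lemma M_series_X: "M_series w fps_X = M_mat w"
  by (auto simp: M_series_def M_mat_def fun_eq_iff)

lemma mat_mult_M_mat:
  assumes "A \<in> lower_tri"
  shows "(A \<star> M_mat w) n k = A n (Suc k) * (w (Suc k) / w k)"
proof -
  have "(A \<star> M_mat w) n k = (\<Sum>j\<le>n. if j = Suc k then A n (Suc k) * (w (Suc k) / w k) else 0)"
    unfolding mat_mult_def by (rule sum.cong) (auto simp: M_mat_def)
  then show ?thesis using assms by (auto simp: lower_tri_def)
qed

lemma M_mat_mult:
  "(M_mat w \<star> A) n k = (if n = 0 then 0 else w n / w (n - 1) * A (n - 1) k)"
proof -
  have "(M_mat w \<star> A) n k = (\<Sum>j\<le>n. if j = n - 1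
      then (if n = 0 then 0 else w n / w (n - 1) * A (n - 1) k) else 0)"
    unfolding mat_mult_def by (rule sum.cong) (auto simp: M_mat_def)
  then show ?thesis by auto
qed

lemma mat_mult_M_series_1_plus:
  assumes w_nz: "\<And>n. w n \<noteq> 0" and "A \<in> lower_tri"
  shows "A \<star> M_series w (1 + f) = (\<lambda>n k. A n k + (A \<star> M_series w f) n k)"
proof (intro ext)
  fix n k
  have "(A \<star> M_series w (1 + f)) n k
      = (\<Sum>j\<le>n. (if j = k then A n k else 0) + A n j * M_series w f j k)"
    unfolding mat_mult_def by (rule sum.cong) (auto simp: M_series_def w_nz algebra_simps)
  also have "\<dots> = A n k + (A \<star> M_series w f) n k"
    using assms(2) by (auto simp: sum.distrib mat_mult_def lower_tri_def)
  finally show "(A \<star> M_series w (1 + f)) n k = A n k + (A \<star> M_series w f) n k" .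
qed

lemma M_series_1_plus_mult:
  assumes w_nz: "\<And>n. w n \<noteq> 0"
  shows "M_series w (1 + f) \<star> A = (\<lambda>n k. A n k + (M_series w f \<star> A) n k)"
proof (intro ext)
  fix n k
  have "(M_series w (1 + f) \<star> A) n k
      = (\<Sum>j\<le>n. (if j = n then A n k else 0) + M_series w f n j * A j k)"
    unfolding mat_mult_def by (rule sum.cong) (auto simp: M_series_def w_nz algebra_simps)
  also have "\<dots> = A n k + (M_series w f \<star> A) n k"
    by (simp add: sum.distrib mat_mult_def)
  finally show "(M_series w (1 + f) \<star> A) n k = A n k + (M_series w f \<star> A) n k" .
qed

text \<open>
  This replaces $M$, which is not invertible, by $1 + M$, which belongs to $L$.
\<close>

lemma intertwine_1_plus_iff:
  assumes "\<And>n. w n \<noteq> 0" "A \<in> lower_tri"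
  shows "A \<star> M_series w (1 + f) = M_series w (1 + g) \<star> A \<longleftrightarrow>
         A \<star> M_series w f = M_series w g \<star> A"
  using assms by (simp add: mat_mult_M_series_1_plus M_series_1_plus_mult fun_eq_iff)

lemma col_fps_nth [simp]: "fps_nth (col_fps w A k) n = A n k / w n"
  by (simp add: col_fps_def)

lemma col_fps_inject:
  assumes "\<And>n. w n \<noteq> 0" "\<And>k. col_fps w A k = col_fps w B k"
  shows "A = B"
proof (intro ext)
  fix n k
  have "A n k / w n = B n k / w n"
    using assms(2) by (metis col_fps_nth)
  then show "A n k = B n k" using assms(1)[of n] by simp
qed

text \<open>
  Up to the weights, $f(M)$ is the Toeplitz matrix of $f$, so its action on a column is the Cauchy
  product with $f$.
\<close>

lemma col_fps_M_series_mult: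
  assumes "\<And>n. w n \<noteq> 0"
  shows "col_fps w (M_series w f \<star> A) k = f * col_fps w A k"
proof (rule fps_ext)
  fix n
  have "fps_nth (f * col_fps w A k) n = (\<Sum>j\<le>n. fps_nth f (n - j) * (A j k / w j))"
    unfolding mult.commute[of f] fps_mult_nth atLeast0AtMost
    by (rule sum.cong) (simp_all add: mult.commute)
  then show "fps_nth (col_fps w (M_series w f \<star> A) k) n = fps_nth (f * col_fps w A k) n"
    using assms by (simp add: mat_mult_def M_series_def sum_divide_distrib field_simps)
qed

lemma col_fps_mult_M_mat:
  assumes "A \<in> lower_tri"
  shows "col_fps w (A \<star> M_mat w) k = fps_const (w (Suc k) / w k) * col_fps w A (Suc k)"
  by (rule fps_ext) (simp add: mat_mult_M_mat[OF assms] fps_mult_left_const_nth)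

lemma col_fps_M_series:
  assumes "\<And>n. w n \<noteq> 0"
  shows "col_fps w (M_series w f) k = fps_const (1 / w k) * fps_X ^ k * f"
  by (rule fps_ext) (use assms in \<open>auto simp: M_series_def fps_X_power_mult_nth mult.assoc\<close>)

lemma M_series_mult:
  assumes "\<And>n. w n \<noteq> 0"
  shows "M_series w f \<star> M_series w g = M_series w (f * g)"
  by (rule col_fps_inject[of w, OF assms])
    (simp add: col_fps_M_series_mult col_fps_M_series assms mult_ac)

text \<open>
  A lower triangular matrix in the commutant of \<open>X\<close> is thus determined by its first column. The diagonals
  of \<open>Z\<close> vanish one after the other. If all diagonals above the \<open>d\<close>-th one are zero, the entries of
  \<open>Z \<star> X = X \<star> Z\<close> on the next diagonal have two terms on each side; one is common to both because the
  diagonal of \<open>X\<close> is constant, and the other expresses each entry of the \<open>d\<close>-th diagonal as a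
  multiple of its predecessor, down to the one in the first column.
\<close>

lemma commuting_zero_column:
  fixes X Z :: "nat \<Rightarrow> nat \<Rightarrow> 'a::field"
  assumes X: "X \<in> lower_tri" "\<And>n. X n n = c" "\<And>n. X (Suc n) n \<noteq> 0"
    and Z: "Z \<in> lower_tri" "\<And>n. Z n 0 = 0" and comm: "Z \<star> X = X \<star> Z"
  shows "Z n k = 0"
proof -
  have "\<forall>k. Z (k + d) k = 0" for d
  proof (induction d rule: less_induct)
    case (less d)
    have vanish: "Z i j = 0" if "i < j + d" for i j
    proof (cases "j \<le> i")
      case True
      with that less.IH[of "i - j"] show ?thesis
        by (metis le_add_diff_inverse less_diff_conv2 add.commute)
    next
      case False
      with Z(1) show ?thesis by (simp add: lower_tri_def)
    qed
    show ?case
    proof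
      fix k
      show "Z (k + d) k = 0"
      proof (induction k)
        case 0
        show ?case by (rule Z(2))
      next
        case (Suc k)
        define m where "m = Suc (k + d)"
        have "(Z \<star> X) m k = (\<Sum>j\<in>{k, Suc k}. Z m j * X j k)"
          unfolding mat_mult_def
        proof (rule sum.mono_neutral_right)
          show "\<forall>j\<in>{..m} - {k, Suc k}. Z m j * X j k = 0"
          proof
            fix j assume j: "j \<in> {..m} - {k, Suc k}"
            then have "j < k \<or> m < j + d" by (simp add: m_def) arith
            then show "Z m j * X j k = 0"
              using vanish X(1) by (auto simp: lower_tri_def)
          qed
        qed (auto simp: m_def)
        moreover have "(X \<star> Z) m k = (\<Sum>j\<in>{k + d, m}. X m j * Z j k)"
          unfolding mat_mult_def
          by (rule sum.mono_neutral_right) (auto simp: m_def intro!: vanish)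
        ultimately have "Z m (Suc k) * X (Suc k) k = X m (k + d) * Z (k + d) k"
          using X(2) fun_cong[OF fun_cong[OF comm, of m], of k] by (simp add: m_def)
        with Suc X(3)[of k] show ?case by (simp add: m_def)
      qed
    qed
  qed
  then show ?thesis
    using Z(1) by (cases "k \<le> n") (metis le_add_diff_inverse, simp add: lower_tri_def)
qed

text \<open>
  The first column of a power series in $M$ can be prescribed freely. So choose $g$ such that $g(M)$ and
  \<open>Y\<close> agree there; both commute with $f(M)$, hence they are equal.
\<close>

lemma commute_M_series_iff:
  assumes w: "\<And>n. w n \<noteq> 0" and f: "fps_nth f 1 \<noteq> 0" and Y: "Y \<in> lower_tri"
  shows "Y \<star> M_series w f = M_series w f \<star> Y \<longleftrightarrow> Y \<in> range (M_series w)"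
proof
  assume comm: "Y \<star> M_series w f = M_series w f \<star> Y"
  define g where "g = Abs_fps (\<lambda>n. Y n 0 * w 0 / w n)"
  define Z where "Z = (\<lambda>n k. Y n k - M_series w g n k)"
  have "Z n k = 0" for n k
  proof (rule commuting_zero_column[where X = "M_series w f" and c = "fps_nth f 0"])
    show "M_series w f n n = fps_nth f 0" for n
      using w by (simp add: M_series_def)
    show "M_series w f (Suc n) n \<noteq> 0" for n
      using w f by (simp add: M_series_def)
    show "Z \<in> lower_tri"
      using Y M_series_lower[of w g] by (auto simp: Z_def lower_tri_def)
    show "Z n 0 = 0" for n
      using w by (simp add: Z_def M_series_def g_def)
    have "M_series w g \<star> M_series w f = M_series w f \<star> M_series w g"
      by (simp add: M_series_mult w mult.commute)
    with comm show "Z \<star> M_series w f = M_series w f \<star> Z"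
      by (simp add: fun_eq_iff mat_mult_def Z_def left_diff_distrib right_diff_distrib sum_subtractf)
  qed (rule M_series_lower)
  then have "Y = M_series w g" by (auto simp: Z_def fun_eq_iff)
  then show "Y \<in> range (M_series w)" by blast
next
  assume "Y \<in> range (M_series w)"
  then show "Y \<star> M_series w f = M_series w f \<star> Y"
    by (auto simp: M_series_mult w mult.commute)
qed

section \<open>Riordan arrays\<close>

text \<open>
  The \<open>k\<close>-th column series, scaled by \<open>w k\<close>, has order exactly \<open>k\<close>, so the quotients in the definition
  are exact and \<open>r\<close> is the quotient iff multiplication by \<open>r\<close> takes each scaled column series to the
  next one.
\<close>

lemma Riordan_iff:
  assumes w: "\<And>n. w n \<noteq> 0" and A: "A \<in> carrier L_group"
  shows "A \<in> Riordan w \<longleftrightarrow> (\<exists>r. A \<star> M_mat w = M_series w r \<star> A)"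
proof -
  have low: "A \<in> lower_tri" and diag: "A n n \<noteq> 0" for n
    using A by (auto simp: L_group_def)
  define F where "F k = fps_const (w k) * col_fps w A k" for k
  have F_nz: "fps_nth (F k) k \<noteq> 0" "F k \<noteq> 0" for k
  proof -
    show "fps_nth (F k) k \<noteq> 0"
      using w diag by (simp add: F_def fps_mult_left_const_nth)
    then show "F k \<noteq> 0" by auto
  qed
  have "subdegree (F k) = k" for k
    using F_nz(1) low by (intro subdegreeI) (auto simp: F_def fps_mult_left_const_nth lower_tri_def)
  then have dvd: "F k dvd F (Suc k)" for k
    using F_nz(2) by (simp add: fps_dvd_iff)
  have quot: "F (Suc k) / F k = r \<longleftrightarrow> F (Suc k) = r * F k" for k r
    using dvd_div_mult_self[OF dvd[of k]] fps_divide_times_eq[OF F_nz(2), of r k] by metis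
  have "A \<star> M_mat w = M_series w r \<star> A \<longleftrightarrow> (\<forall>k. F (Suc k) = r * F k)" for r
  proof -
    have "A \<star> M_mat w = M_series w r \<star> A \<longleftrightarrow>
        (\<forall>k. col_fps w (A \<star> M_mat w) k = col_fps w (M_series w r \<star> A) k)"
      by (auto intro: col_fps_inject[of w, OF w])
    also have "\<dots> \<longleftrightarrow> (\<forall>k. F (Suc k) = r * F k)"
    proof (intro all_cong1)
      fix k
      have F_Suc: "F (Suc k) = fps_const (w k) * col_fps w (A \<star> M_mat w) k"
        using w low by (simp add: F_def col_fps_mult_M_mat flip: mult.assoc)
      have rF: "r * F k = fps_const (w k) * col_fps w (M_series w r \<star> A) k"
        by (simp add: F_def col_fps_M_series_mult w mult.left_commute)
      show "col_fps w (A \<star> M_mat w) k = col_fps w (M_series w r \<star> A) k \<longleftrightarrow>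
          F (Suc k) = r * F k"
        unfolding F_Suc rF using w by simp
    qed
    finally show ?thesis .
  qed
  then show ?thesis
    using A quot by (simp add: Riordan_def F_def)
qed

section \<open>Operators on polynomials and their matrices\<close>

text \<open>
  Vectors are rows here: the \<open>n\<close>-th row holds the coefficients of the image of $x^n$. This fits the
  convention that the rows of the matrix of a graded sequence are its polynomials, but it makes
  composition of operators reverse the order of multiplication.
\<close>

definition op_matrix :: "('a::field poly \<Rightarrow> 'a poly) \<Rightarrow> nat \<Rightarrow> nat \<Rightarrow> 'a" where
  "op_matrix T = seq_matrix (\<lambda>n. T (monom 1 n))"

lemma graded_seq_monom: "(\<And>n. c n \<noteq> 0) \<Longrightarrow> graded_seq (\<lambda>n. monom (c n) n)"
  by (simp add: graded_seq_def degree_monom_eq)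

lemma seq_matrix_inject: "seq_matrix p = seq_matrix q \<longleftrightarrow> p = q"
  by (auto simp: seq_matrix_def fun_eq_iff poly_eq_iff)

lemma seq_matrix_image_mem_L: "seq_matrix ` {p. graded_seq p} = carrier L_group"
proof (intro equalityI subsetI)
  fix A :: "nat \<Rightarrow> nat \<Rightarrow> 'a"
  assume "A \<in> seq_matrix ` {p. graded_seq p}"
  then obtain p where p: "graded_seq p" and A: "A = seq_matrix p" by blast
  have "coeff (p n) n \<noteq> 0" for n
    using p by (metis graded_seq_def leading_coeff_0_iff)
  then show "A \<in> carrier L_group"
    using p by (auto simp: A L_group_def lower_tri_def seq_matrix_def graded_seq_def coeff_eq_0)
next
  fix A :: "nat \<Rightarrow> nat \<Rightarrow> 'a"
  assume "A \<in> carrier L_group"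
  then have low: "n < k \<Longrightarrow> A n k = 0" and diag: "A n n \<noteq> 0" for n k
    by (auto simp: L_group_def lower_tri_def)
  define p where "p n = (\<Sum>k\<le>n. monom (A n k) k)" for n
  have co: "coeff (p n) k = A n k" for n k
    using low by (auto simp: p_def coeff_sum)
  have "degree (p n) = n" for n
    using co low diag by (intro antisym degree_le le_degree) auto
  moreover have "p n \<noteq> 0" for n
    using co[of n n] diag by auto
  ultimately have "graded_seq p" by (simp add: graded_seq_def)
  moreover have "A = seq_matrix p" using co by (simp add: seq_matrix_def)
  ultimately show "A \<in> seq_matrix ` {p. graded_seq p}" by blast
qed

lemma seq_matrix_image:
  assumes T: "Vector_Spaces.linear smult smult T" and p: "seq_matrix p \<in> lower_tri"
  shows "seq_matrix (\<lambda>n. T (p n)) = seq_matrix p \<star> op_matrix T"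
proof (intro ext)
  interpret lin: Vector_Spaces.linear smult smult T by (rule T)
  fix n k
  have deg: "degree (p n) \<le> n"
    using p by (intro degree_le) (auto simp: lower_tri_def seq_matrix_def)
  have "T (p n) = T (\<Sum>i\<le>n. smult (coeff (p n) i) (monom 1 i))"
    using poly_as_sum_of_monoms'[OF deg] by (simp add: smult_monom)
  also have "\<dots> = (\<Sum>i\<le>n. smult (coeff (p n) i) (T (monom 1 i)))"
    by (simp add: lin.sum lin.scale)
  finally show "seq_matrix (\<lambda>n. T (p n)) n k = (seq_matrix p \<star> op_matrix T) n k"
    by (simp add: seq_matrix_def op_matrix_def mat_mult_def coeff_sum)
qed

lemma op_matrix_comp:
  assumes "Vector_Spaces.linear smult smult S" "op_matrix T \<in> lower_tri"
  shows "op_matrix (S \<circ> T) = op_matrix T \<star> op_matrix S"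
  using seq_matrix_image[of S "\<lambda>n. T (monom 1 n)"] assms by (simp add: op_matrix_def)

lemma op_matrix_inject:
  assumes "Vector_Spaces.linear smult smult S" "Vector_Spaces.linear smult smult T"
  shows "op_matrix S = op_matrix T \<longleftrightarrow> S = T"
proof
  assume "op_matrix S = op_matrix T"
  then have "S (monom 1 n) = T (monom 1 n)" for n
    unfolding op_matrix_def seq_matrix_inject by (rule fun_cong)
  then show "S = T"
    using lin_op_ex1[OF graded_seq_monom[of "\<lambda>_. 1"], of "\<lambda>n. T (monom 1 n)"] assms
    by (metis zero_neq_one)
qed simp

lemma lin_op:
  assumes "graded_seq b"
  shows "Vector_Spaces.linear smult smult (lin_op b q)" "lin_op b q (b n) = q n"
  using theI'[OF lin_op_ex1[OF assms, of q]] by (simp_all add: lin_op_def)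

lemma linear_Q_op:
  assumes "\<And>n. w n \<noteq> 0" "graded_seq p"
  shows "Vector_Spaces.linear smult smult (Q_op w p)"
  unfolding Q_op_def by (rule lin_op(1)) (use assms in \<open>simp add: graded_seq_def\<close>)

text \<open>
  Both sides are the matrix of the sequence of images of the \<open>p n\<close>, computed on the left from the
  expansion of \<open>p n\<close> in powers of $x$ and on the right from the prescribed values of the operator.
\<close>

lemma Q_op_matrix:
  assumes w: "\<And>n. w n \<noteq> 0" and p: "graded_seq p"
  shows "seq_matrix p \<star> op_matrix (Q_op w p) = M_mat w \<star> seq_matrix p"
proof -
  have low: "seq_matrix p \<in> lower_tri"
    using seq_matrix_image_mem_L p by (auto simp: L_group_def)
  note lin = linear_Q_op[OF assms]
  have "Q_op w p (p n) = (if n = 0 then 0 else smult (w n / w (n - 1)) (p (n - 1)))" for n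
  proof -
    have "smult (1 / w n) (Q_op w p (p n)) = Q_op w p (smult (1 / w n) (p n))"
      using lin by (simp add: linear_smult_iff)
    also have "\<dots> = (if n = 0 then 0 else smult (1 / w (n - 1)) (p (n - 1)))"
      unfolding Q_op_def by (rule lin_op(2)) (use assms in \<open>simp add: graded_seq_def\<close>)
    finally have "smult (w n) (smult (1 / w n) (Q_op w p (p n))) =
        smult (w n) (if n = 0 then 0 else smult (1 / w (n - 1)) (p (n - 1)))" by simp
    then show ?thesis using w by (simp split: if_splits)
  qed
  then have "seq_matrix (\<lambda>n. Q_op w p (p n)) = M_mat w \<star> seq_matrix p"
    by (auto simp: seq_matrix_def M_mat_mult fun_eq_iff)
  then show ?thesis using seq_matrix_image[OF lin low] by simp
qed

lemma D_op_eq_Q_op: "D_op w = Q_op w (monom 1)"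
  by (simp add: D_op_def Q_op_def smult_monom cong: if_cong)

lemma one_mat_mult:
  fixes A :: "nat \<Rightarrow> nat \<Rightarrow> 'a::field"
  shows "(\<lambda>n k. if n = k then 1 else 0) \<star> A = A"
  by (simp add: mat_mult_def if_distrib[where f = "\<lambda>c. c * _"] cong: if_cong)

lemma mat_mult_one:
  fixes A :: "nat \<Rightarrow> nat \<Rightarrow> 'a::field"
  assumes "A \<in> lower_tri"
  shows "A \<star> (\<lambda>n k. if n = k then 1 else 0) = A"
  using assms
  by (auto simp: mat_mult_def lower_tri_def fun_eq_iff
      if_distrib[where f = "\<lambda>c. _ * c"] cong: if_cong)

lemma D_op_matrix:
  assumes w: "\<And>n. w n \<noteq> 0"
  shows "op_matrix (D_op w) = M_mat w"
proof -
  have one: "seq_matrix (monom 1) = (\<lambda>n k. if n = k then 1 else 0)"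
    by (simp add: seq_matrix_def fun_eq_iff)
  show ?thesis
    using Q_op_matrix[of w, OF w graded_seq_monom[of "\<lambda>_. 1"]]
    by (simp add: D_op_eq_Q_op one one_mat_mult mat_mult_one M_mat_lower)
qed

lemma linear_T_op:
  assumes "\<And>n. w n \<noteq> 0"
  shows "Vector_Spaces.linear smult smult (T_op w h)"
  unfolding T_op_def by (intro lin_op(1) graded_seq_monom) (use assms in simp)

lemma T_op_matrix:
  assumes w: "\<And>n. w n \<noteq> 0"
  shows "op_matrix (T_op w h) = M_series w (Abs_fps (\<lambda>n. h ^ n / w n))"
proof (intro ext)
  fix n k
  have "T_op w h (monom 1 n) = T_op w h (smult (w n) (monom (1 / w n) n))"
    using w by (simp add: smult_monom)
  also have "\<dots> = smult (w n) (T_op w h (monom (1 / w n) n))"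
    using linear_T_op[of w, OF w] by (simp add: linear_smult_iff)
  also have "T_op w h (monom (1 / w n) n) =
      (\<Sum>k\<le>n. smult (h ^ (n - k) / w (n - k)) (monom (1 / w k) k))"
    unfolding T_op_def by (intro lin_op(2) graded_seq_monom) (use w in simp)
  finally show "op_matrix (T_op w h) n k = M_series w (Abs_fps (\<lambda>n. h ^ n / w n)) n k"
    by (simp add: op_matrix_def seq_matrix_def M_series_def coeff_sum smult_monom)
qed

section \<open>Appell and Sheffer sequences in terms of matrices\<close>

lemma L_cancel:
  assumes A: "A \<in> carrier L_group"
  shows "A \<star> X = A \<star> Y \<longleftrightarrow> X = Y"
    and "inv\<^bsub>L_group\<^esub> A \<star> (A \<star> X) = X" and "A \<star> (inv\<^bsub>L_group\<^esub> A \<star> X) = X"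
proof -
  interpret group "L_group :: (nat \<Rightarrow> nat \<Rightarrow> 'a) monoid" by (rule group_L)
  have low: "A \<in> lower_tri" "inv\<^bsub>L_group\<^esub> A \<in> lower_tri"
    using A inv_closed[OF A] by (auto simp: L_group_def)
  have one: "inv\<^bsub>L_group\<^esub> A \<star> A = (\<lambda>n k. if n = k then 1 else 0)"
      "A \<star> inv\<^bsub>L_group\<^esub> A = (\<lambda>n k. if n = k then 1 else 0)"
    using l_inv[OF A] r_inv[OF A] by (simp_all add: L_group_def)
  show "inv\<^bsub>L_group\<^esub> A \<star> (A \<star> X) = X" for X
    using mat_mult_assoc[OF low(1), of "inv\<^bsub>L_group\<^esub> A" X] by (simp add: one one_mat_mult)
  then show "A \<star> X = A \<star> Y \<longleftrightarrow> X = Y" by metis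
  show "A \<star> (inv\<^bsub>L_group\<^esub> A \<star> X) = X"
    using mat_mult_assoc[OF low(2), of A X] by (simp add: one one_mat_mult)
qed

lemma seq_matrix_Collect:
  assumes "\<And>p. graded_seq p \<Longrightarrow> P p \<longleftrightarrow> S (seq_matrix p)"
  shows "{seq_matrix p | p. graded_seq p \<and> P p} = {A \<in> carrier L_group. S A}"
  using assms by (auto simp flip: seq_matrix_image_mem_L)

lemma Appell_matrices_eq:
  assumes w: "\<And>n. w n \<noteq> 0"
  shows "Appell_matrices w = {A \<in> carrier L_group. A \<star> M_mat w = M_mat w \<star> A}"
  unfolding Appell_matrices_def W_Appell_def
proof (rule seq_matrix_Collect)
  fix p :: "nat \<Rightarrow> 'a poly"
  assume p: "graded_seq p"
  then have A: "seq_matrix p \<in> carrier L_group"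
    using seq_matrix_image_mem_L by blast
  have "Q_op w p = D_op w \<longleftrightarrow> op_matrix (Q_op w p) = op_matrix (D_op w)"
    using linear_Q_op[of w, OF w p] linear_Q_op[of w, OF w graded_seq_monom[of "\<lambda>_. 1"]]
    by (simp add: op_matrix_inject D_op_eq_Q_op)
  also have "\<dots> \<longleftrightarrow> seq_matrix p \<star> op_matrix (Q_op w p) = seq_matrix p \<star> op_matrix (D_op w)"
    by (simp add: L_cancel(1)[OF A])
  also have "\<dots> \<longleftrightarrow> seq_matrix p \<star> M_mat w = M_mat w \<star> seq_matrix p"
    by (auto simp: Q_op_matrix[of w, OF w p] D_op_matrix[of w, OF w])
  finally show "Q_op w p = D_op w \<longleftrightarrow> seq_matrix p \<star> M_mat w = M_mat w \<star> seq_matrix p" .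
qed

text \<open>
  The matrix \<open>K\<close> of \<open>Q_op w p\<close> has to commute with $W(hM)$ for all $h$. The case $h = 1$ already makes it a
  power series in $M$, because the linear coefficient of $W$ is $1 / w_1$; and power series in $M$
  commute with each other.
\<close>

lemma Sheffer_matrices_eq:
  assumes w: "\<And>n. w n \<noteq> 0"
  shows "Sheffer_matrices w = {A \<in> carrier L_group. \<exists>q. A \<star> M_series w q = M_mat w \<star> A}"
  unfolding Sheffer_matrices_def W_Sheffer_def
proof (rule seq_matrix_Collect)
  fix p :: "nat \<Rightarrow> 'a poly"
  assume p: "graded_seq p"
  define A where "A = seq_matrix p"
  define K where "K = op_matrix (Q_op w p)"
  have A: "A \<in> carrier L_group"
    using seq_matrix_image_mem_L p by (auto simp: A_def)
  have low: "A \<in> lower_tri" "inv\<^bsub>L_group\<^esub> A \<in> lower_tri"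
    using A group.inv_closed[OF group_L A] by (auto simp: L_group_def)
  have AK: "A \<star> K = M_mat w \<star> A"
    by (simp add: A_def K_def Q_op_matrix[of w, OF w p])
  then have "K = inv\<^bsub>L_group\<^esub> A \<star> (M_mat w \<star> A)"
    using L_cancel(2)[OF A, of K] by simp
  then have K_low: "K \<in> lower_tri"
    using low by (simp add: mat_mult_lower M_mat_lower)
  define f where "f h = Abs_fps (\<lambda>n. h ^ n / w n)" for h
  have T: "op_matrix (T_op w h) = M_series w (f h)" for h
    by (simp add: T_op_matrix[of w, OF w] f_def)
  have comp: "Q_op w p \<circ> T_op w h = T_op w h \<circ> Q_op w p \<longleftrightarrow>
      K \<star> M_series w (f h) = M_series w (f h) \<star> K" for h
  proof -
    note lin = linear_Q_op[of w, OF w p] linear_T_op[of w h, OF w]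
    have "Vector_Spaces.linear smult smult (Q_op w p \<circ> T_op w h)"
      "Vector_Spaces.linear smult smult (T_op w h \<circ> Q_op w p)"
      using lin by (auto simp: linear_smult_iff)
    then have "Q_op w p \<circ> T_op w h = T_op w h \<circ> Q_op w p \<longleftrightarrow>
        op_matrix (Q_op w p \<circ> T_op w h) = op_matrix (T_op w h \<circ> Q_op w p)"
      by (simp add: op_matrix_inject)
    also have "\<dots> \<longleftrightarrow> M_series w (f h) \<star> K = K \<star> M_series w (f h)"
      using lin K_low by (simp add: op_matrix_comp T M_series_lower K_def)
    finally show ?thesis by auto
  qed
  have "(\<forall>h. Q_op w p \<circ> T_op w h = T_op w h \<circ> Q_op w p) \<longleftrightarrow> K \<in> range (M_series w)"
  proof
    assume "\<forall>h. Q_op w p \<circ> T_op w h = T_op w h \<circ> Q_op w p"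
    moreover have "fps_nth (f 1) 1 \<noteq> 0" using w by (simp add: f_def)
    ultimately show "K \<in> range (M_series w)"
      using comp commute_M_series_iff[of w, OF w _ K_low] by blast
  next
    assume "K \<in> range (M_series w)"
    then show "\<forall>h. Q_op w p \<circ> T_op w h = T_op w h \<circ> Q_op w p"
      by (auto simp: comp M_series_mult[of w, OF w] mult.commute)
  qed
  also have "\<dots> \<longleftrightarrow> (\<exists>q. A \<star> M_series w q = A \<star> K)"
    by (auto simp: L_cancel(1)[OF A])
  finally show "(\<forall>h. Q_op w p \<circ> T_op w h = T_op w h \<circ> Q_op w p) \<longleftrightarrow>
      (\<exists>q. seq_matrix p \<star> M_series w q = M_mat w \<star> seq_matrix p)"
    by (simp add: AK A_def[symmetric])
qed

section \<open>Stabilizer, centralizer and normalizer\<close>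

lemma ex_fps_1_plus: "(\<exists>s. P s) \<longleftrightarrow> (\<exists>r. P (1 + r))" for P :: "'a::field fps \<Rightarrow> bool"
  by (metis add_diff_cancel_left' diff_add_cancel add.commute)

theorem theorem4p4:
  fixes w :: "nat \<Rightarrow> 'a::field"
  assumes "w 0 = 1" and "\<And>n. w n \<noteq> 0"
  shows "subgroup (Appell_matrices w) L_group
       \<and> Appell_matrices w = stabilizer L_group conj_action (M_mat w)
       \<and> subgroup (Riordan w) L_group
       \<and> Riordan w = Sheffer_matrices w
       \<and> Riordan w = normalizer L_group (Appell_matrices w)"
proof -
  note w = assms(2)
  let ?L = "L_group :: (nat \<Rightarrow> nat \<Rightarrow> 'a) monoid"
  interpret group ?L by (rule group_L)
  define E where "E = M_series w (1 + fps_X)"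
  define C where "C = Appell_matrices w"
  have mult: "(\<otimes>\<^bsub>?L\<^esub>) = (\<star>)" by (simp add: L_group_def)
  have one: "\<one>\<^bsub>?L\<^esub> = (\<lambda>n k. if n = k then 1 else 0)" by (simp add: L_group_def)
  have low: "A \<in> carrier ?L \<Longrightarrow> A \<in> lower_tri" for A by (simp add: L_group_def)
  have E: "E \<in> carrier ?L"
    using w by (simp add: E_def L_group_def M_series_lower) (simp add: M_series_def)
  have C: "C = {A \<in> carrier ?L. A \<otimes>\<^bsub>?L\<^esub> E = E \<otimes>\<^bsub>?L\<^esub> A}"
    using intertwine_1_plus_iff[of w, OF w low, of _ fps_X fps_X]
    by (auto simp: C_def Appell_matrices_eq[of w, OF w] mult E_def M_series_X)
  have C_series: "A \<in> C \<longleftrightarrow> A \<in> range (M_series w)" if "A \<in> carrier ?L" for A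
    using commute_M_series_iff[of w, OF w _ low[OF that], of "1 + fps_X"] that by (simp add: C mult E_def)
  have abelian: "A \<otimes>\<^bsub>?L\<^esub> B = B \<otimes>\<^bsub>?L\<^esub> A" if "A \<in> C" "B \<in> C" for A B
  proof -
    have "A \<in> range (M_series w)" "B \<in> range (M_series w)"
      using that C_series C by auto
    then show ?thesis by (auto simp: mult M_series_mult[of w, OF w] mult.commute)
  qed
  have conj: "A \<otimes>\<^bsub>?L\<^esub> E \<otimes>\<^bsub>?L\<^esub> inv\<^bsub>?L\<^esub> A = B \<longleftrightarrow> A \<star> E = B \<star> A"
    if A: "A \<in> carrier ?L" and B: "B \<in> lower_tri" for A B
  proof -
    have "B \<star> A \<star> inv\<^bsub>?L\<^esub> A = B"
      using A B low mat_mult_assoc[of A B "inv\<^bsub>?L\<^esub> A"] r_inv[OF A]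
      by (simp add: mult one mat_mult_one)
    moreover have "A \<otimes>\<^bsub>?L\<^esub> E \<otimes>\<^bsub>?L\<^esub> inv\<^bsub>?L\<^esub> A \<otimes>\<^bsub>?L\<^esub> A = A \<otimes>\<^bsub>?L\<^esub> E"
      using A E by (simp add: m_assoc)
    ultimately show ?thesis by (metis mult)
  qed
  have inv_conj: "inv\<^bsub>?L\<^esub> A \<otimes>\<^bsub>?L\<^esub> E \<otimes>\<^bsub>?L\<^esub> A = B \<longleftrightarrow> A \<star> B = E \<star> A"
    if A: "A \<in> carrier ?L" for A B
    using L_cancel(2,3)[OF A] mat_mult_assoc[OF low[OF E]] by (metis mult)
  have Riordan: "Riordan w = {A \<in> carrier ?L. A \<otimes>\<^bsub>?L\<^esub> E \<otimes>\<^bsub>?L\<^esub> inv\<^bsub>?L\<^esub> A \<in> C}"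
  proof -
    have "A \<in> Riordan w \<longleftrightarrow> A \<otimes>\<^bsub>?L\<^esub> E \<otimes>\<^bsub>?L\<^esub> inv\<^bsub>?L\<^esub> A \<in> C" if A: "A \<in> carrier ?L" for A
    proof -
      have "A \<in> Riordan w \<longleftrightarrow> (\<exists>r. A \<star> E = M_series w (1 + r) \<star> A)"
        using intertwine_1_plus_iff[of w, OF w low[OF A], of fps_X]
        by (simp add: Riordan_iff[of w, OF w A] E_def M_series_X)
      also have "\<dots> \<longleftrightarrow> (\<exists>s. A \<otimes>\<^bsub>?L\<^esub> E \<otimes>\<^bsub>?L\<^esub> inv\<^bsub>?L\<^esub> A = M_series w s)"
        using conj[OF A M_series_lower] ex_fps_1_plus[of "\<lambda>s. A \<star> E = M_series w s \<star> A"] by simp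
      also have "\<dots> \<longleftrightarrow> A \<otimes>\<^bsub>?L\<^esub> E \<otimes>\<^bsub>?L\<^esub> inv\<^bsub>?L\<^esub> A \<in> C"
        using A E by (subst C_series) auto
      finally show ?thesis .
    qed
    then show ?thesis by (auto simp: Riordan_def)
  qed
  have Sheffer: "Sheffer_matrices w = {A \<in> carrier ?L. inv\<^bsub>?L\<^esub> A \<otimes>\<^bsub>?L\<^esub> E \<otimes>\<^bsub>?L\<^esub> A \<in> C}"
  proof -
    have "(\<exists>q. A \<star> M_series w q = M_mat w \<star> A) \<longleftrightarrow> inv\<^bsub>?L\<^esub> A \<otimes>\<^bsub>?L\<^esub> E \<otimes>\<^bsub>?L\<^esub> A \<in> C"
      if A: "A \<in> carrier ?L" for A
    proof -
      have "(\<exists>q. A \<star> M_series w q = M_mat w \<star> A) \<longleftrightarrow> (\<exists>q. A \<star> M_series w (1 + q) = E \<star> A)"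
        using intertwine_1_plus_iff[of w, OF w low[OF A], of _ fps_X] by (simp add: E_def M_series_X)
      also have "\<dots> \<longleftrightarrow> (\<exists>s. inv\<^bsub>?L\<^esub> A \<otimes>\<^bsub>?L\<^esub> E \<otimes>\<^bsub>?L\<^esub> A = M_series w s)"
        using inv_conj[OF A] ex_fps_1_plus[of "\<lambda>s. A \<star> M_series w s = E \<star> A"] by simp
      also have "\<dots> \<longleftrightarrow> inv\<^bsub>?L\<^esub> A \<otimes>\<^bsub>?L\<^esub> E \<otimes>\<^bsub>?L\<^esub> A \<in> C"
        using A E by (subst C_series) auto
      finally show ?thesis .
    qed
    then show ?thesis by (auto simp: Sheffer_matrices_eq[of w, OF w])
  qed
  have "subgroup C ?L"
    unfolding C by (rule centralizer_subgroup[OF E])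
  moreover have "C = stabilizer ?L conj_action (M_mat w)"
  proof -
    have "conj_action A (M_mat w) = M_mat w \<longleftrightarrow> A \<star> M_mat w = M_mat w \<star> A"
      if A: "A \<in> carrier ?L" for A
      using L_cancel(2,3)[OF A] mat_mult_assoc[OF M_mat_lower[of w]]
      by (simp add: conj_action_def M_mat_strictly_lower) metis
    then show ?thesis
      by (auto simp: C_def Appell_matrices_eq[of w, OF w] stabilizer_def)
  qed
  moreover have normalizer: "Riordan w = normalizer ?L C"
    using Riordan normalizer_abelian_centralizer[OF E C abelian] by simp
  moreover have "Riordan w = Sheffer_matrices w"
    using conj_commute_flip[OF _ E] E by (auto simp: Riordan Sheffer C)
  moreover have "subgroup (Riordan w) ?L"
    using normalizer_imp_subgroup[of C] by (auto simp: normalizer C)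
  ultimately show ?thesis by (simp add: C_def)
qed

end
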